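(* For any Polish space $X$ there is a sequence $f_1\geq f_2\geq\ldots$ of continuous functions $f_n:X\to[0,1]$ which converges to zero pointwise on $X$ but does not converge uniformly on any subset $A\subseteq X$ whose closure in $X$ is not compact. *)

theory Defs
  imports "HOL-Analysis.Analysis"
begin

text \<open>
  The library class \<open>polish_space\<close> fixes a complete metric and covers only spaces that are
  whole (hence nonempty) types.  Being Polish is a property of the topology alone, so it is
  stated here for abstract topologies.
\<close>

definition Polish_space :: "'a topology \<Rightarrow> bool" where
  "Polish_space X \<longleftrightarrow> separable_space X \<and> completely_metrizable_space X"

end

theory Submission
  imports Defs
begin

text \<open>
  Fix a complete metric and a dense sequence \<open>q\<close>, and let \<open>f n x\<close> be the distance from \<open>x\<close> to
  \<open>{q 0, \<dots>, q (n - 1)}\<close>, truncated at \<open>1\<close>.  Density gives pointwise convergence to zero.  If the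
  convergence is uniform on \<open>A\<close>, then for every \<open>\<epsilon>\<close> finitely many \<open>\<epsilon>\<close>-balls around the \<open>q k\<close>
  cover \<open>A\<close>, so \<open>A\<close> is totally bounded and, by completeness, has compact closure.
\<close>

context Metric_space
begin

text \<open>\<open>mtotally_bounded\<close> asks for centres inside \<open>A\<close>, whereas the
  balls at hand are centred at points \<open>q k\<close> that may lie outside \<open>A\<close>.
  Replacing each centre by a point of \<open>A\<close> in its ball only doubles the radius.\<close>

lemma mtotally_boundedI:
  assumes "A \<subseteq> M"
    and cover: "\<And>\<epsilon>. \<epsilon> > 0 \<Longrightarrow> \<exists>K. finite K \<and> A \<subseteq> (\<Union>x\<in>K. mball x \<epsilon>)"
  shows "mtotally_bounded A"
  unfolding mtotally_bounded_def
proof (intro strip)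
  fix \<epsilon> :: real assume "\<epsilon> > 0"
  then obtain K where "finite K" and K: "A \<subseteq> (\<Union>x\<in>K. mball x (\<epsilon>/2))"
    using cover [of "\<epsilon>/2"] by auto
  \<comment> \<open>Balls that miss \<open>A\<close> are dropped, so that each remaining one
    supplies a new centre.\<close>
  define K' where "K' = {x \<in> K. A \<inter> mball x (\<epsilon>/2) \<noteq> {}}"
  have "\<forall>x\<in>K'. \<exists>a. a \<in> A \<inter> mball x (\<epsilon>/2)"
    by (auto simp: K'_def)
  then obtain a where a: "\<And>x. x \<in> K' \<Longrightarrow> a x \<in> A \<inter> mball x (\<epsilon>/2)"
    by metis
  have "A \<subseteq> (\<Union>y\<in>a ` K'. mball y \<epsilon>)"
  proof
    fix y assume "y \<in> A"
    then obtain x where "x \<in> K" and y: "y \<in> mball x (\<epsilon>/2)"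
      using K by auto
    then have x: "x \<in> K'"
      using \<open>y \<in> A\<close> by (auto simp: K'_def)
    have "d (a x) y \<le> d (a x) x + d x y"
      using a [OF x] y by (intro triangle) auto
    also have "\<dots> < \<epsilon>"
      using a [OF x] y by (auto simp: commute)
    finally have "y \<in> mball (a x) \<epsilon>"
      using a [OF x] y by auto
    then show "y \<in> (\<Union>y\<in>a ` K'. mball y \<epsilon>)"
      using x by blast
  qed
  moreover have "finite (a ` K')"
    using \<open>finite K\<close> by (simp add: K'_def)
  moreover have "a ` K' \<subseteq> A"
    using a by blast
  ultimately show "\<exists>K. finite K \<and> K \<subseteq> A \<and> A \<subseteq> (\<Union>x\<in>K. mball x \<epsilon>)"
    by blast
qed

lemma continuous_map_dist_point:
  assumes "a \<in> M"
  shows "continuous_map mtopology euclideanreal (\<lambda>x. d x a)"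
proof -
  have "continuous_map mtopology euclideanreal
          (\<lambda>x. mdist (metric (M, d)) x ((\<lambda>_. a) x))"
    using assms
    by (intro continuous_map_mdist) (simp_all add: mtopology_of_def flip: id_def)
  then show ?thesis
    by simp
qed

end

text \<open>The element \<open>1\<close> truncates the distance and makes \<open>Min\<close> meaningful for \<open>n = 0\<close>.\<close>

definition trunc_dist :: "('a \<Rightarrow> 'a \<Rightarrow> real) \<Rightarrow> (nat \<Rightarrow> 'a) \<Rightarrow> nat \<Rightarrow> 'a \<Rightarrow> real" where
  "trunc_dist d q n x = Min (insert 1 ((\<lambda>k. d x (q k)) ` {..<n}))"

text \<open>This recursion lets continuity be proved by induction on \<open>n\<close>, one binary
  minimum at a time.\<close>

lemma trunc_dist_Suc: "trunc_dist d q (Suc n) x = min (d x (q n)) (trunc_dist d q n x)"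
  by (simp add: trunc_dist_def lessThan_Suc insert_commute [of 1])

lemma trunc_dist_less_iff:
  "trunc_dist d q n x < e \<longleftrightarrow> 1 < e \<or> (\<exists>k<n. d x (q k) < e)"
  by (auto simp: trunc_dist_def Min_less_iff)

lemma trunc_dist_le_1: "trunc_dist d q n x \<le> 1"
  by (simp add: trunc_dist_def)

lemma antimono_trunc_dist: "m \<le> n \<Longrightarrow> trunc_dist d q n x \<le> trunc_dist d q m x"
  unfolding trunc_dist_def by (intro Min_antimono) auto

context Metric_space
begin

lemma trunc_dist_nonneg: "0 \<le> trunc_dist d q n x"
  by (auto simp: trunc_dist_def)

lemma continuous_map_trunc_dist:
  assumes "range q \<subseteq> M"
  shows "continuous_map mtopology euclideanreal (trunc_dist d q n)"
proof (induction n)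
  case 0
  then show ?case by (simp add: trunc_dist_def [abs_def])
next
  case (Suc n)
  then show ?case
    using assms
    by (auto simp: trunc_dist_Suc [abs_def]
        intro!: continuous_map_real_min continuous_map_dist_point)
qed

lemma trunc_dist_tendsto_0:
  assumes "x \<in> mtopology closure_of range q"
  shows "(\<lambda>n. trunc_dist d q n x) \<longlonglongrightarrow> 0"
proof (rule order_tendstoI)
  fix e :: real assume "0 < e"
  then obtain k where "d x (q k) < e"
    using assms by (force simp: metric_closure_of)
  then show "\<forall>\<^sub>F n in sequentially. trunc_dist d q n x < e"
    \<comment> \<open>The bound holds from \<open>Suc k\<close> on, since stage \<open>n\<close>
      only sees indices below \<open>n\<close>.\<close>
    unfolding eventually_sequentially trunc_dist_less_iff by (meson Suc_le_lessD)
qed (meson always_eventually less_le_trans trunc_dist_nonneg)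

lemma uniform_limit_trunc_dist_imp_mtotally_bounded:
  assumes "A \<subseteq> M" "range q \<subseteq> M" "uniform_limit A (trunc_dist d q) (\<lambda>_. 0) sequentially"
  shows "mtotally_bounded A"
proof (rule mtotally_boundedI [OF \<open>A \<subseteq> M\<close>])
  fix \<epsilon> :: real assume "\<epsilon> > 0"
  \<comment> \<open>Capping at 1 excludes the alternative \<open>1 < e\<close> in
    \<open>trunc_dist_less_iff\<close>: a value below this bound must come from an actual point
    \<open>q k\<close>.\<close>
  then have "min \<epsilon> 1 > 0"
    by simp
  from uniform_limitD [OF assms(3) this]
  obtain n where "\<forall>x\<in>A. dist (trunc_dist d q n x) 0 < min \<epsilon> 1"
    by (auto simp: eventually_sequentially)
  then have n: "trunc_dist d q n x < min \<epsilon> 1" if "x \<in> A" for x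
    using that by fastforce
  have "A \<subseteq> (\<Union>y\<in>q ` {..<n}. mball y \<epsilon>)"
  proof
    fix x assume "x \<in> A"
    with n obtain k where "k < n" "d x (q k) < \<epsilon>"
      by (fastforce simp: trunc_dist_less_iff)
    then show "x \<in> (\<Union>y\<in>q ` {..<n}. mball y \<epsilon>)"
      using \<open>x \<in> A\<close> assms(1,2) by (auto simp: commute intro!: bexI [of _ k])
  qed
  then show "\<exists>K. finite K \<and> A \<subseteq> (\<Union>x\<in>K. mball x \<epsilon>)"
    by (meson finite_imageI finite_lessThan)
qed

end

theorem theorem2p1:
  fixes X :: "'a topology"
  assumes "Polish_space X"
  shows "\<exists>f :: nat \<Rightarrow> 'a \<Rightarrow> real.
           (\<forall>n. continuous_map X (top_of_set {0..1}) (f n)) \<and>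
           (\<forall>n. \<forall>x\<in>topspace X. f (Suc n) x \<le> f n x) \<and>
           (\<forall>x\<in>topspace X. (\<lambda>n. f n x) \<longlonglongrightarrow> 0) \<and>
           (\<forall>A. A \<subseteq> topspace X \<and> \<not> compactin X (X closure_of A)
                 \<longrightarrow> \<not> uniformly_convergent_on A f)"
proof (cases "topspace X = {}")
  \<comment> \<open>There is no dense sequence to enumerate here, but every \<open>A\<close> is
    empty and has compact closure.\<close>
  case True
  then show ?thesis
    by (intro exI [of _ "\<lambda>_ _. 0"]) (auto simp: continuous_map_def)
next
  case False
  obtain M d where "Metric_space M d" and complete: "Metric_space.mcomplete M d"
    and X: "X = Metric_space.mtopology M d"
    using assms by (auto simp: Polish_space_def completely_metrizable_space_def)
  interpret Metric_space M d by fact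
  obtain D where "countable D" "D \<subseteq> M" and D: "mtopology closure_of D = M"
    using assms by (auto simp: Polish_space_def separable_space_def X)
  have "D \<noteq> {}"
    using D False X by auto
  \<comment> \<open>If \<open>D\<close> is finite, this enumeration repeats points, which is
    harmless: only its range matters.\<close>
  define q where "q = from_nat_into D"
  have q: "range q = D"
    by (simp add: q_def \<open>D \<noteq> {}\<close> \<open>countable D\<close> range_from_nat_into)
  define f where "f = trunc_dist d q"
  have lim: "(\<lambda>n. f n x) \<longlonglongrightarrow> 0" if "x \<in> M" for x
    unfolding f_def using that D q by (intro trunc_dist_tendsto_0) simp
  \<comment> \<open>The last clause is proved in contrapositive form.\<close>
  have "compactin mtopology (mtopology closure_of A)"
    if "A \<subseteq> M" and unif: "uniformly_convergent_on A f" for A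
  proof -
    obtain l where l: "uniform_limit A f l sequentially"
      using unif by (auto simp: uniformly_convergent_on_def)
    \<comment> \<open>Uniform convergence comes with an unspecified limit; the pointwise limit
      identifies it as 0 on \<open>A\<close>.\<close>
    have "l x = 0" if "x \<in> A" for x
      using tendsto_uniform_limitI [OF l that] lim \<open>A \<subseteq> M\<close> that LIMSEQ_unique by blast
    then have "uniform_limit A f (\<lambda>_. 0) sequentially"
      using l by (simp cong: uniform_limit_cong')
    then have "mtotally_bounded A"
      using \<open>A \<subseteq> M\<close> \<open>D \<subseteq> M\<close> q
      by (auto simp: f_def intro: uniform_limit_trunc_dist_imp_mtotally_bounded)
    then show ?thesis
      using complete \<open>A \<subseteq> M\<close> mtotally_bounded_eq_compact_closure_of by blast
  qed
  moreover have "continuous_map mtopology (top_of_set {0..1}) (f n)" for n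
    using \<open>D \<subseteq> M\<close> q
    by (simp add: continuous_map_in_subtopology f_def continuous_map_trunc_dist
        trunc_dist_nonneg trunc_dist_le_1 image_subset_iff Pi_iff)
  ultimately show ?thesis
    using lim by (intro exI [of _ f]) (auto simp: X f_def antimono_trunc_dist)
qed

end
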